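(* Let $N\ge1$, $0<p<1$, $\mu\in\mathbb{R}\setminus\{0\}$, and let $\mu^*=\frac{2(p+1)}{(1-p)^2}$. Consider $$u''+\frac{N-1}{r}u'+\frac{\mu}{\delta(r)^2}u=u^p\qquad(\ast)$$ for $r\in(0,R)$ (ball $B_R$) or $r\in(r_0,R)$, $r_0>0$ (annulus). (i) Let $R_0$ be a given point in $(r_0,R)$ in the case of an annulus, or in $(0,R)$ in the case of a ball. Then in a small neighborhood of $R_0$ there exists a solution of $(\ast)$, positive for $r\ne R_0$, which is of the form $u(r)=|r-R_0|^{\frac{2}{1-p}}(c_p+w(r-R_0))$ and has the property $u(R_0)=u'(R_0)=0$. Moreover $w$ is continuous, $w(0)=0$, and $c_p=(\mu^* )^{\frac{1}{p-1}}$. (ii) If $R_0=r_0>0$ or $R_0=R$, then the same statement (in a small one-sided neighborhood of $R_0$ inside the domain) holds true provided $\mu>-\mu^*$. In this case $c_p$ has to be replaced by $c'=(\mu^*+\mu)^{\frac{1}{p-1}}$. (iii) In the ball, near the origin, there exists a local solution of $(\ast)$ of the form $u(r)=r^{\frac{2}{1-p}}(c''+w(r))$ with $c''=\Big(\mu^*+\frac{2(N-1)}{1-p}\Big)^{\frac{1}{p-1}}$, $w$ continuous and $w(0)=0$.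
   Context: $\delta(r)$ is the distance to the boundary: $\delta(r)=R-r$ for the ball $B_R=\{x\in\mathbb{R}^N:|x|<R\}$ and $\delta(r)=\min\{R-r,\,r-r_0\}$ for the annulus $\{x\in\mathbb{R}^N:r_0<|x|<R\}$; $(\ast)$ is the equation for radial solutions of $\Delta u+\frac{\mu}{\delta(x)^2}u=u^p$. *)

theory Defs
  imports Complex_Main
begin

definition mu_star :: "real \<Rightarrow> real" where
  "mu_star p = 2 * (p + 1) / (1 - p)\<^sup>2"

definition delta_ball :: "real \<Rightarrow> real \<Rightarrow> real" where
  "delta_ball R r = R - r"

definition delta_annulus :: "real \<Rightarrow> real \<Rightarrow> real \<Rightarrow> real" where
  "delta_annulus r0 R r = min (R - r) (r - r0)"

text \<open>Nonnegative classical (twice continuously differentiable) solutions on an open set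
  \<open>I\<close>; nonnegativity is what gives the power on the right-hand side its meaning.\<close>

definition radial_solution_on ::
    "real set \<Rightarrow> nat \<Rightarrow> real \<Rightarrow> real \<Rightarrow> (real \<Rightarrow> real) \<Rightarrow> (real \<Rightarrow> real) \<Rightarrow> bool" where
  "radial_solution_on I N p \<mu> \<delta> u \<longleftrightarrow>
     (\<exists>u' u''. continuous_on I u'' \<and>
        (\<forall>r\<in>I. 0 \<le> u r \<and>
           (u has_real_derivative u' r) (at r) \<and>
           (u' has_real_derivative u'' r) (at r) \<and>
           u'' r + (real N - 1) / r * u' r + \<mu> / (\<delta> r)\<^sup>2 * u r = u r powr p))"

text \<open>Here \<open>D\<close> is the interval of radii of the domain and \<open>J\<close> a (possibly one-sided)
  neighbourhood of \<open>R0\<close>. The point \<open>R0\<close> may be an endpoint of \<open>D\<close>; there \<open>\<delta>\<close> vanishes, so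
  the equation is required on \<open>J \<inter> D\<close> only, and the derivative at \<open>R0\<close> is relative to \<open>J\<close>.\<close>

definition vanishing_solution ::
    "real set \<Rightarrow> nat \<Rightarrow> real \<Rightarrow> real \<Rightarrow> (real \<Rightarrow> real) \<Rightarrow> real \<Rightarrow> real \<Rightarrow> real set \<Rightarrow> bool" where
  "vanishing_solution D N p \<mu> \<delta> c R0 J \<longleftrightarrow>
     J - {R0} \<subseteq> D \<and>
     (\<exists>u w. radial_solution_on (J \<inter> D) N p \<mu> \<delta> u \<and>
        (\<forall>r\<in>J - {R0}. 0 < u r) \<and>
        (\<forall>r\<in>J. u r = \<bar>r - R0\<bar> powr (2 / (1 - p)) * (c + w (r - R0))) \<and>
        u R0 = 0 \<and> (u has_real_derivative 0) (at R0 within J) \<and>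
        continuous_on ((\<lambda>r. r - R0) ` J) w \<and> w 0 = 0)"

end

theory Submission
  imports Defs "HOL-Analysis.Analysis"
begin

text \<open>Put \<open>\<alpha> = 2/(1-p)\<close>, \<open>t = \<bar>r - R0\<bar>\<close>, \<open>u = t\<^sup>\<alpha> (c + t \<omega>(t))\<close> and \<open>\<theta> = t d/dt\<close>. With
  \<open>c = K powr (1/(p-1))\<close>, where \<open>K\<close> collects the coefficients of the most singular terms, the
  equation becomes \<open>(\<theta> + 1 + k1) (\<theta> + 1 + k2) \<omega> = \<Phi>(t, \<omega>, (\<theta> + 1) \<omega>)\<close>, where \<open>\<Phi>\<close> is a contraction in
  \<open>(\<omega>, (\<theta> + 1) \<omega>)\<close> for small \<open>t\<close>, while \<open>k1 + k2 = 2\<alpha> - 1 + a\<close> and \<open>k1 k2 = (1-p) K\<close> are positive, so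
  that \<open>k1\<close>, \<open>k2\<close> have positive real part. Hence \<open>\<theta> + 1 + k\<close> has the bounded inverse
  \<open>g \<mapsto> (t \<mapsto> \<integral>\<^sub>0\<^sup>1 s\<^sup>k g(t s) ds)\<close>, and the equation for \<open>\<phi> = \<Phi>(t, \<omega>, (\<theta> + 1) \<omega>)\<close> is solved by Banach's
  fixed point theorem.\<close>

subsection \<open>The inverse of an Euler operator\<close>

text \<open>For \<open>t > 0\<close> this is t^(-k-1) times the integral of s^k g(s) over [0, t].
  The rescaling to the fixed interval [0, 1] avoids the singular prefactor and keeps the value
  continuous across \<open>t = 0\<close>. The exponent is complex because the characteristic roots
  may be non-real.\<close>

definition hardy :: "complex \<Rightarrow> (real \<Rightarrow> complex) \<Rightarrow> real \<Rightarrow> complex" where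
  "hardy k g t = integral {0..1} (\<lambda>s. of_real s powr k * g (t * s))"

lemma continuous_on_hardy_integrand:
  assumes "0 < Re k" "continuous_on UNIV g"
  shows "continuous_on {0..1} (\<lambda>s. of_real s powr k * g (t * s))"
  using assms by (auto intro!: continuous_intros continuous_on_compose2[OF assms(2)])

lemma continuous_on_hardy:
  assumes k: "0 < Re k" and g: "continuous_on UNIV g"
  shows "continuous_on UNIV (hardy k g)"
proof -
  have "continuous_on (UNIV \<times> cbox 0 1) (\<lambda>(t, s). complex_of_real s powr k * g (t * s))"
    unfolding split_beta using k
    by (intro continuous_intros continuous_on_compose2[OF g]) auto
  from integral_continuous_on_param[OF this] show ?thesis
    by (simp add: hardy_def[abs_def])
qed

text \<open>The weight has modulus s^(Re k), which is at most 1 on [0, 1]. The resulting constant 1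
  is not sharp, but it is enough for the contraction estimate.\<close>

lemma norm_hardy_le:
  assumes k: "0 < Re k" and g: "continuous_on UNIV g" and B: "\<And>s. norm (g s) \<le> B"
  shows "norm (hardy k g t) \<le> B"
proof -
  have "norm (integral {0..1} (\<lambda>s. of_real s powr k * g (t * s))) \<le> B * (1 - 0)"
  proof (rule integral_bound)
    fix s :: real assume s: "s \<in> {0..1}"
    have "s powr Re k \<le> 1" using s k powr_mono2[of "Re k" s 1] by auto
    then have "norm (complex_of_real s powr k) \<le> 1"
      using s by (subst norm_powr_real_powr) auto
    then show "norm (complex_of_real s powr k * g (t * s)) \<le> B"
      using B[of "t * s"] norm_ge_zero[of "g (t * s)"]
      by (simp add: norm_mult) (meson mult_left_le_one_le norm_ge_zero order_trans)
  qed (use continuous_on_hardy_integrand[OF k g] in auto)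
  then show ?thesis by (simp add: hardy_def)
qed

lemma hardy_diff:
  assumes k: "0 < Re k" and "continuous_on UNIV g" "continuous_on UNIV h"
  shows "hardy k g t - hardy k h t = hardy k (\<lambda>s. g s - h s) t"
  unfolding hardy_def
  by (subst integral_diff[symmetric])
    (auto intro!: integrable_continuous_real continuous_on_hardy_integrand assms simp: right_diff_distrib)

lemma norm_hardy_diff_le:
  assumes k: "0 < Re k" and g: "continuous_on UNIV g" "continuous_on UNIV h"
    and B: "\<And>s. norm (g s - h s) \<le> B"
  shows "norm (hardy k g t - hardy k h t) \<le> B"
  unfolding hardy_diff[OF assms(1-3)]
  by (rule norm_hardy_le) (use assms in \<open>auto intro: continuous_intros\<close>)

text \<open>This is (\<theta> + 1 + k) \<open>hardy k g\<close> = g for \<theta> = t d/dt. After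
  rescaling back to an integral over [0, t], it is the product rule together with the fundamental
  theorem of calculus.\<close>

lemma has_vector_derivative_hardy:
  assumes k: "0 < Re k" and g: "continuous_on UNIV g" and t: "0 < t"
  shows "(hardy k g has_vector_derivative (g t - (k + 1) * hardy k g t) /\<^sub>R t) (at t)"
proof -
  define h where "h s = of_real s powr k * g s" for s
  define H where "H x = integral {0..x} h" for x
  have cont: "continuous_on {0..b} h" for b
    unfolding h_def using k
    by (intro continuous_intros continuous_on_subset[OF g]) auto
  have H: "(H has_vector_derivative h x) (at x within {0..b})" if "0 \<le> x" "x \<le> b" for x b
    unfolding H_def using that by (intro integral_has_vector_derivative cont) auto
  have eq: "hardy k g x = of_real x powr (- k - 1) * H x" if x: "0 < x" for x
  proof -
    \<comment> \<open>The substitution is carried out by exhibiting a rescaled copy of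
      \<open>H\<close> as an antiderivative in \<open>s\<close>; its value at \<open>s = 0\<close>
      vanishes.\<close>
    have "((\<lambda>s. of_real s powr k * g (x * s)) has_integral
        of_real x powr (- k - 1) * H (x * 1) - of_real x powr (- k - 1) * H (x * 0)) {0..1}"
    proof (rule fundamental_theorem_of_calculus)
      fix s :: real assume s: "s \<in> {0..1}"
      have "(H has_vector_derivative h (x * s)) (at (x * s) within {0..x})"
        using s x by (intro H) (auto simp: mult_left_le)
      moreover have "(\<lambda>s. x * s) ` {0..1} \<subseteq> {0..x}" using x by (auto simp: mult_left_le)
      ultimately have "(H has_vector_derivative h (x * s)) (at (x * s) within (\<lambda>s. x * s) ` {0..1})"
        by (rule has_vector_derivative_within_subset)
      then have "((H \<circ> (\<lambda>s. x * s)) has_vector_derivative x *\<^sub>R h (x * s)) (at s within {0..1})"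
        by (intro vector_diff_chain_within) (auto intro!: derivative_eq_intros)
      then have "((\<lambda>s. H (x * s)) has_vector_derivative x *\<^sub>R h (x * s)) (at s within {0..1})"
        by (simp add: o_def)
      then have "((\<lambda>s. of_real x powr (- k - 1) * H (x * s)) has_vector_derivative
          of_real x powr (- k - 1) * (x *\<^sub>R h (x * s))) (at s within {0..1})"
        by (rule has_vector_derivative_mult_right)
      moreover have "complex_of_real x powr (- k - 1) * (x *\<^sub>R h (x * s)) = of_real s powr k * g (x * s)"
        using x s by (auto simp: h_def scaleR_conv_of_real powr_times_real powr_diff powr_minus)
      ultimately show "((\<lambda>s. of_real x powr (- k - 1) * H (x * s)) has_vector_derivative
          of_real s powr k * g (x * s)) (at s within {0..1})" by simp
    qed simp
    then show ?thesis
      by (simp add: hardy_def H_def integral_unique)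
  qed
  \<comment> \<open>The right end \<open>t + 1\<close> makes \<open>t\<close> an interior point, so
    the relative derivative is a full one.\<close>
  have "(H has_vector_derivative h t) (at t within {0..t + 1})" using t by (intro H) auto
  then have dH: "(H has_vector_derivative h t) (at t)"
    using t at_within_interior[of t "{0..t + 1}"] by auto
  have "((\<lambda>x. complex_of_real x powr (- k - 1)) has_vector_derivative
      (- k - 1) * of_real t powr (- k - 1 - 1)) (at t)"
    using t by (intro has_vector_derivative_real_field has_field_derivative_powr) auto
  from has_vector_derivative_mult[OF this dH]
  have "((\<lambda>x. of_real x powr (- k - 1) * H x) has_vector_derivative
      of_real t powr (- k - 1) * h t + (- k - 1) * of_real t powr (- k - 1 - 1) * H t) (at t)" .
  moreover have "of_real t powr (- k - 1) * h t + (- k - 1) * of_real t powr (- k - 1 - 1) * H t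
      = (g t - (k + 1) * hardy k g t) /\<^sub>R t"
    using t by (simp add: eq h_def powr_diff powr_minus scaleR_conv_of_real field_simps power2_eq_square)
  ultimately have "((\<lambda>x. of_real x powr (- k - 1) * H x) has_vector_derivative
      (g t - (k + 1) * hardy k g t) /\<^sub>R t) (at t)" by simp
  then show ?thesis
    by (rule has_vector_derivative_transform_within_open[where S="{0<..}"]) (use t eq in auto)
qed

section \<open>Cut-off of the nonlinearity and characteristic roots\<close>

text \<open>Replacing \<open>g\<close> outside \<open>[-\<eta>, \<eta>]\<close> makes it globally Lipschitz, so that the fixed point argument needs no
  invariant ball. The factor \<open>H\<close> makes \<open>g(t x) / t = x H(t x)\<close> continuous up to \<open>t = 0\<close>.\<close>

lemma superlinear_extension:
  fixes g g' :: "real \<Rightarrow> real"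
  assumes d: "0 < d" and der: "\<And>x. \<bar>x\<bar> < d \<Longrightarrow> (g has_real_derivative g' x) (at x)"
    and cont: "isCont g' 0" and g0: "g 0 = 0" "g' 0 = 0" and L: "0 < L"
  obtains \<eta> H where "0 < \<eta>" "continuous_on UNIV H" "H 0 = 0"
    "\<And>x. \<bar>x\<bar> \<le> \<eta> \<Longrightarrow> g x = x * H x"
    "\<And>x y. \<bar>x * H x - y * H y\<bar> \<le> L * \<bar>x - y\<bar>"
proof -
  obtain e where e: "0 < e" "\<And>x. \<bar>x\<bar> < e \<Longrightarrow> \<bar>g' x\<bar> < L"
    using cont g0 L unfolding continuous_at_real_range by auto
  define \<eta> where "\<eta> = min (d / 2) (e / 2)"
  have \<eta>: "0 < \<eta>" "\<eta> < d" "\<eta> < e" using d e by (auto simp: \<eta>_def)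
  \<comment> \<open>Clamping is nonexpansive, so \<open>g\<close> composed with \<open>cl\<close>
    inherits the Lipschitz constant \<open>L\<close> that \<open>g\<close> has on
    [-\<eta>, \<eta>].\<close>
  define cl where "cl x = max (- \<eta>) (min \<eta> x)" for x
  have cl: "\<bar>cl x\<bar> \<le> \<eta>" for x using \<eta> by (auto simp: cl_def)
  have cl_lip: "\<bar>cl x - cl y\<bar> \<le> \<bar>x - y\<bar>" for x y using \<eta> by (auto simp: cl_def)
  have cl_id: "cl x = x" if "\<bar>x\<bar> \<le> \<eta>" for x using that by (auto simp: cl_def)
  have lip: "\<bar>g x - g y\<bar> \<le> L * \<bar>x - y\<bar>" if "\<bar>x\<bar> \<le> \<eta>" "\<bar>y\<bar> \<le> \<eta>" for x y
  proof -
    have "norm (g x - g y) \<le> L * norm (x - y)"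
    proof (rule field_differentiable_bound[where S="{-\<eta>..\<eta>}" and f'=g'])
      fix z assume "z \<in> {-\<eta>..\<eta>}"
      then have "\<bar>z\<bar> < d" "\<bar>z\<bar> < e" using \<eta> by auto
      then show "(g has_field_derivative g' z) (at z within {-\<eta>..\<eta>})" "norm (g' z) \<le> L"
        using der[of z] e(2)[of z] by (auto intro: has_field_derivative_at_within)
    qed (use that in auto)
    then show ?thesis by simp
  qed
  \<comment> \<open>The value 0 at the origin is the limit of the quotient, because
    \<open>g' 0 = 0\<close>.\<close>
  define H where "H x = (if x = 0 then 0 else g (cl x) / x)" for x
  have xH: "x * H x = g (cl x)" for x using g0 cl_id[of 0] \<eta> by (simp add: H_def)
  have "isCont H x" for x
  proof (cases "x = 0")
    case True
    have "((\<lambda>y. (g y - g 0) / (y - 0)) \<longlongrightarrow> 0) (at 0)"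
      using der[of 0] d g0 by (simp add: has_field_derivative_iff)
    moreover have "eventually (\<lambda>y. (g y - g 0) / (y - 0) = H y) (at 0)"
      unfolding eventually_at using \<eta> cl_id g0 by (intro exI[of _ \<eta>]) (auto simp: H_def)
    ultimately have "(H \<longlongrightarrow> 0) (at 0)" by (rule Lim_transform_eventually)
    then show ?thesis using True by (simp add: isCont_def H_def)
  next
    case False
    have "continuous_on {-\<eta>..\<eta>} g"
      using \<eta> by (intro DERIV_continuous_on[where D=g'] has_field_derivative_at_within[OF der]) auto
    then have "continuous_on UNIV (\<lambda>x. g (cl x))"
      
    proof (rule continuous_on_compose2)
      show "continuous_on UNIV cl" unfolding cl_def by (intro continuous_intros)
      show "cl ` UNIV \<subseteq> {-\<eta>..\<eta>}" using cl by (auto simp: abs_le_iff minus_le_iff)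
    qed
    then have "isCont (\<lambda>x. g (cl x) / x) x"
      using False by (intro continuous_intros) (auto simp: continuous_on_eq_continuous_at)
    moreover have "eventually (\<lambda>y. g (cl y) / y = H y) (nhds x)"
      using False t1_space_nhds[of x 0] by (auto simp: H_def elim!: eventually_mono)
    ultimately show ?thesis by (simp cong: isCont_cong)
  qed
  moreover have "\<bar>x * H x - y * H y\<bar> \<le> L * \<bar>x - y\<bar>" for x y
    unfolding xH using lip[OF cl[of x] cl[of y]] mult_left_mono[OF cl_lip[of x y], of L] L by linarith
  moreover have "H 0 = 0" by (simp add: H_def)
  ultimately show ?thesis
    by (intro that[of \<eta> H]) (use \<eta> in \<open>auto simp: xH cl_id continuous_on_eq_continuous_at\<close>)
qed

text \<open>These are the roots of z^2 - b z + q. If they are real, \<open>q > 0\<close> keeps the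
  square root of the discriminant below \<open>b\<close>; otherwise they are conjugate with real
  part b/2.\<close>

lemma quadratic_roots_Re_pos:
  fixes b q :: real
  assumes "0 < b" "0 < q"
  obtains k1 k2 :: complex where "k1 + k2 = of_real b" "k1 * k2 = of_real q" "0 < Re k1" "0 < Re k2"
proof (cases "4 * q \<le> b\<^sup>2")
  case True
  define s where "s = sqrt (b\<^sup>2 - 4 * q)"
  have s: "s\<^sup>2 = b\<^sup>2 - 4 * q" "0 \<le> s" using True by (auto simp: s_def)
  then have "s < b" using assms by (intro power_less_imp_less_base[of s 2 b]) auto
  have "(b + s) / 2 * ((b - s) / 2) = q" using s by (simp add: power2_eq_square algebra_simps)
  then have "complex_of_real ((b + s) / 2) * of_real ((b - s) / 2) = of_real q"
    by (metis of_real_mult)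
  moreover have "complex_of_real ((b + s) / 2) + of_real ((b - s) / 2) = of_real b"
    by (simp add: field_simps)
  ultimately show ?thesis
    by (intro that[of "complex_of_real ((b + s) / 2)" "of_real ((b - s) / 2)"])
      (use assms \<open>s < b\<close> s(2) in auto)
next
  case False
  define s where "s = sqrt (4 * q - b\<^sup>2)"
  have s: "s\<^sup>2 = 4 * q - b\<^sup>2" using False by (auto simp: s_def)
  show ?thesis
    by (rule that[of "Complex (b/2) (s/2)" "Complex (b/2) (- s/2)"])
      (use s assms in \<open>auto simp: complex_eq_iff power2_eq_square algebra_simps\<close>)
qed

subsection \<open>The fixed point argument\<close>

text \<open>Here \<open>v\<close> stands for \<open>(\<theta> + 1) \<omega>\<close>. The roots \<open>k1\<close>, \<open>k2\<close> may be non-real; the integral operators act on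
  complex-valued functions, and since \<open>b\<close> and \<open>q\<close> are real it suffices to take real parts at the end.\<close>

lemma singular_system_solution:
  fixes P Q H :: "real \<Rightarrow> real" and b q c \<alpha> d :: real
  assumes b: "0 < b" and q: "0 < q" and d: "0 < d"
    and P: "continuous_on UNIV P" and Q: "continuous_on UNIV Q" and H: "continuous_on UNIV H" and H0: "H 0 = 0"
    and lip: "\<And>x y. \<bar>x * H x - y * H y\<bar> \<le> \<bar>x - y\<bar> / 4"
  obtains \<epsilon> \<omega> v where "0 < \<epsilon>" "\<epsilon> \<le> d" "continuous_on UNIV \<omega>" "continuous_on UNIV v"
    "\<And>t. 0 < t \<Longrightarrow> t < \<epsilon> \<Longrightarrow> (\<omega> has_real_derivative (v t - \<omega> t) / t) (at t)"
    "\<And>t. 0 < t \<Longrightarrow> t < \<epsilon> \<Longrightarrow> (v has_real_derivative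
        (\<omega> t * H (t * \<omega> t) - t * P t * v t - (\<alpha> * P t + t * Q t) * (c + t * \<omega> t)
          - (1 + b) * v t - q * \<omega> t) / t) (at t)"
proof -
  obtain k1 k2 :: complex where k: "k1 + k2 = of_real b" "k1 * k2 = of_real q" "0 < Re k1" "0 < Re k2"
    using quadratic_roots_Re_pos[OF b q] .
  obtain M where M: "\<And>t. 0 \<le> t \<Longrightarrow> t \<le> 1 \<Longrightarrow> \<bar>P t\<bar> \<le> M \<and> \<bar>Q t\<bar> \<le> M"
  proof -
    have "bounded (P ` {0..1})" "bounded (Q ` {0..1})"
      by (intro compact_imp_bounded compact_continuous_image
          continuous_on_subset[OF P] continuous_on_subset[OF Q]; simp)+
    then obtain M1 M2 where "\<forall>t\<in>{0..1}. \<bar>P t\<bar> \<le> M1" "\<forall>t\<in>{0..1}. \<bar>Q t\<bar> \<le> M2"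
      unfolding bounded_iff by (auto simp: image_iff)
    then show ?thesis by (intro that[of "max M1 M2"]) (auto simp: le_max_iff_disj)
  qed
  have M0: "0 \<le> M" using M[of 0] by auto
  \<comment> \<open>\<open>C\<close> dominates the Lipschitz constants of all terms carrying a
    factor \<open>t\<close>: \<open>1 + cmod k1\<close> comes from \<open>vv\<close>, the rest from
    the factor of \<open>c + t * \<omega> t\<close>. The choice of \<epsilon> makes their joint
    contribution at most 1/4, and the summand 1 gives \<epsilon> at most 1/4.\<close>
  define C where "C = M * (1 + cmod k1) + \<bar>\<alpha>\<bar> * M + M + 1"
  have C: "1 \<le> C" using M0 by (auto simp: C_def)
  define \<epsilon> where "\<epsilon> = min d (1 / (4 * C))"
  have \<epsilon>: "0 < \<epsilon>" "\<epsilon> \<le> d" "\<epsilon> \<le> 1" "\<epsilon> * C \<le> 1 / 4"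
    using d C mult_right_mono[of \<epsilon> "1 / (4 * C)" C] by (auto simp: \<epsilon>_def min_le_iff_disj)
  \<comment> \<open>Freezing the argument outside [0, \<epsilon>] yields bounded continuous
    functions on the whole line, hence a complete space, without altering the equation on the
    interval of interest.\<close>
  define cl where "cl t = max 0 (min \<epsilon> t)" for t
  have cl: "0 \<le> cl t" "cl t \<le> \<epsilon>" "cl t \<le> 1" for t using \<epsilon> by (auto simp: cl_def)
  have cont_cl: "continuous_on UNIV cl" unfolding cl_def by (intro continuous_intros)
  \<comment> \<open>The unknown is the right-hand side \<open>f\<close> of the factored equation,
    not \<omega> itself. Inverting the factors in turn gives \<psi> and then \<open>X\<close>, so no
    derivative has to be controlled in the iteration.\<close>
  define \<psi> :: "(real \<Rightarrow>\<^sub>C real) \<Rightarrow> real \<Rightarrow> complex"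
    where "\<psi> f = hardy k2 (\<lambda>t. complex_of_real (f t))" for f
  define X where "X f = hardy k1 (\<psi> f)" for f
  have cf: "continuous_on UNIV (\<lambda>t. complex_of_real (apply_bcontfun f t))" for f :: "real \<Rightarrow>\<^sub>C real"
    by (intro continuous_intros) simp
  have c\<psi>: "continuous_on UNIV (\<psi> f)" for f
    unfolding \<psi>_def by (rule continuous_on_hardy[OF k(4) cf])
  have cX: "continuous_on UNIV (X f)" for f
    unfolding X_def by (rule continuous_on_hardy[OF k(3) c\<psi>])
  have l\<psi>: "norm (\<psi> f t - \<psi> g t) \<le> dist f g" for f g t
    unfolding \<psi>_def
    by (rule norm_hardy_diff_le[OF k(4) cf cf])
      (metis dist_bounded dist_norm dist_of_real)
  have lX: "norm (X f t - X g t) \<le> dist f g" for f g t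
    unfolding X_def by (rule norm_hardy_diff_le[OF k(3) c\<psi> c\<psi> l\<psi>])
  define om where "om f t = Re (X f t)" for f t
  \<comment> \<open>Since (\<theta> + 1 + k1) \<open>X f\<close> = \<open>\<psi> f\<close>, this is
    the real part of (\<theta> + 1) \<open>X f\<close>.\<close>
  define vv where "vv f t = Re (\<psi> f t - k1 * X f t)" for f t
  have com: "continuous_on UNIV (om f)" for f unfolding om_def by (intro continuous_intros cX)
  have cvv: "continuous_on UNIV (vv f)" for f unfolding vv_def by (intro continuous_intros cX c\<psi>)
  have lom: "\<bar>om f t - om g t\<bar> \<le> dist f g" for f g t
    using lX[of f t g] abs_Re_le_cmod[of "X f t - X g t"] by (simp add: om_def)
  have lvv: "\<bar>vv f t - vv g t\<bar> \<le> (1 + cmod k1) * dist f g" for f g t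
  proof -
    have "\<bar>vv f t - vv g t\<bar> \<le> cmod ((\<psi> f t - \<psi> g t) - k1 * (X f t - X g t))"
      unfolding vv_def by (rule order_trans[OF _ abs_Re_le_cmod]) (simp add: algebra_simps)
    also have "\<dots> \<le> cmod (\<psi> f t - \<psi> g t) + cmod k1 * cmod (X f t - X g t)"
      by (metis norm_mult norm_triangle_ineq4)
    also have "\<dots> \<le> dist f g + cmod k1 * dist f g"
      by (intro add_mono mult_left_mono l\<psi> lX) auto
    finally show ?thesis by (simp add: algebra_simps)
  qed
  define G where "G f t = om f t * H (t * om f t) - t * P t * vv f t
      - (\<alpha> * P t + t * Q t) * (c + t * om f t)" for f t
  have cG: "continuous_on UNIV (G f)" for f
    unfolding G_def
    by (intro continuous_intros com cvv P Q continuous_on_compose2[OF H]) auto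
  have lG: "\<bar>G f t - G g t\<bar> \<le> 1 / 2 * dist f g" if t: "0 \<le> t" "t \<le> \<epsilon>" for f g t
  proof -
    let ?D = "dist f g"
    have t1: "t \<le> 1" using t \<epsilon> by auto
    note M = M[OF t(1) t1]
    \<comment> \<open>The Lipschitz hypothesis concerns x H(x), so the difference is multiplied by
      \<open>t\<close> and then divided by it; at \<open>t = 0\<close> both terms vanish by
      \<open>H0\<close>.\<close>
    have 1: "\<bar>om f t * H (t * om f t) - om g t * H (t * om g t)\<bar> \<le> ?D / 4"
    proof (cases "t = 0")
      case True
      then show ?thesis by (simp add: H0)
    next
      case False
      with t have "0 < t" by simp
      have "t * \<bar>om f t * H (t * om f t) - om g t * H (t * om g t)\<bar>
          = \<bar>(t * om f t) * H (t * om f t) - (t * om g t) * H (t * om g t)\<bar>"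
        using \<open>0 < t\<close> by (simp add: mult.assoc abs_mult flip: right_diff_distrib)
      also have "\<dots> \<le> \<bar>t * om f t - t * om g t\<bar> / 4" by (rule lip)
      also have "\<dots> = t * (\<bar>om f t - om g t\<bar> / 4)"
        using \<open>0 < t\<close> by (simp add: abs_mult flip: right_diff_distrib)
      finally show ?thesis using \<open>0 < t\<close> lom[of f t g] by simp
    qed
    have 2: "\<bar>t * P t * (vv f t - vv g t)\<bar> \<le> \<epsilon> * M * ((1 + cmod k1) * ?D)"
      unfolding abs_mult using t M M0 lvv[of f t g] by (intro mult_mono) auto
    have "\<bar>\<alpha> * P t + t * Q t\<bar> \<le> \<bar>\<alpha> * P t\<bar> + \<bar>t * Q t\<bar>" by (rule abs_triangle_ineq)
    also have "\<dots> \<le> \<bar>\<alpha>\<bar> * M + 1 * M"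
      unfolding abs_mult using t t1 M M0 by (intro add_mono mult_mono) auto
    finally have 3: "\<bar>(\<alpha> * P t + t * Q t) * (t * (om f t - om g t))\<bar> \<le> (\<bar>\<alpha>\<bar> * M + M) * (\<epsilon> * ?D)"
      unfolding abs_mult[of "\<alpha> * P t + t * Q t"] abs_mult[of t]
      using t M0 lom[of f t g] by (intro mult_mono) auto
    have "G f t - G g t = (om f t * H (t * om f t) - om g t * H (t * om g t))
       - t * P t * (vv f t - vv g t) - (\<alpha> * P t + t * Q t) * (t * (om f t - om g t))"
      by (simp add: G_def algebra_simps)
    then have "\<bar>G f t - G g t\<bar> \<le> ?D / 4 + \<epsilon> * M * ((1 + cmod k1) * ?D) + (\<bar>\<alpha>\<bar> * M + M) * (\<epsilon> * ?D)"
      using 1 2 3 by linarith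
    also have "\<dots> \<le> ?D / 4 + (\<epsilon> * C) * ?D"
      using \<epsilon> by (simp add: C_def algebra_simps)
    also have "\<dots> \<le> ?D / 4 + 1 / 4 * ?D"
      using \<epsilon> by (intro add_mono mult_right_mono) auto
    finally show ?thesis by simp
  qed
  define F where "F f = Bcontfun (\<lambda>t. G f (cl t))" for f
  have F: "apply_bcontfun (F f) t = G f (cl t)" for f t
  proof -
    have "continuous_on UNIV (\<lambda>t. G f (cl t))"
      by (rule continuous_on_compose2[OF cG cont_cl]) auto
    moreover have "bounded (range (\<lambda>t. G f (cl t)))"
    proof (rule bounded_subset)
      show "bounded (G f ` {0..\<epsilon>})"
        by (intro compact_imp_bounded compact_continuous_image continuous_on_subset[OF cG]) auto
    qed (use cl in auto)
    ultimately show ?thesis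
      unfolding F_def by (subst Bcontfun_inverse) (auto simp: bcontfun_def)
  qed
  \<comment> \<open>The constant 1/2 is 1/4 from the \<open>H\<close> term plus 1/4 from the terms
    collected in \<open>C\<close>.\<close>
  have "\<exists>!f. F f = f"
  proof (rule banach_fix_type[of "1 / 2"]; (intro allI dist_bound)?)
    show "dist (F f t) (F g t) \<le> 1 / 2 * dist f g" for f g t
      unfolding F dist_real_def by (intro lG cl)
  qed auto
  then obtain f where f: "F f = f" by blast
  have fG: "f t = G f t" if "0 < t" "t < \<epsilon>" for t
    using F[of f t] f that by (simp add: cl_def)
  show ?thesis
  proof (rule that[OF \<epsilon>(1,2) com[of f] cvv[of f]])
    fix t :: real assume t: "0 < t" "t < \<epsilon>"
    have dX: "(X f has_vector_derivative (\<psi> f t - (k1 + 1) * X f t) /\<^sub>R t) (at t)"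
      unfolding X_def by (rule has_vector_derivative_hardy[OF k(3) c\<psi> t(1)])
    have d\<psi>: "(\<psi> f has_vector_derivative (of_real (f t) - (k2 + 1) * \<psi> f t) /\<^sub>R t) (at t)"
      unfolding \<psi>_def by (rule has_vector_derivative_hardy[OF k(4) cf t(1)])
    have "(om f has_vector_derivative Re ((\<psi> f t - (k1 + 1) * X f t) /\<^sub>R t)) (at t)"
      unfolding om_def by (rule bounded_linear.has_vector_derivative[OF bounded_linear_Re dX])
    moreover have "Re ((\<psi> f t - (k1 + 1) * X f t) /\<^sub>R t) = (vv f t - om f t) / t"
    proof -
      have "\<psi> f t - (k1 + 1) * X f t = (\<psi> f t - k1 * X f t) - X f t" by (simp add: algebra_simps)
      then show ?thesis
        by (simp only: vv_def om_def scaleR_complex.simps minus_complex.simps divide_inverse mult.commute)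
    qed
    ultimately show "(om f has_real_derivative (vv f t - om f t) / t) (at t)"
      by (simp only: has_real_derivative_iff_has_vector_derivative)
    have "((\<lambda>t. \<psi> f t - k1 * X f t) has_vector_derivative
        (of_real (f t) - (k2 + 1) * \<psi> f t) /\<^sub>R t - k1 * ((\<psi> f t - (k1 + 1) * X f t) /\<^sub>R t)) (at t)"
      by (intro derivative_intros dX d\<psi>)
    from bounded_linear.has_vector_derivative[OF bounded_linear_Re this]
    have "(vv f has_vector_derivative
        Re ((of_real (f t) - (k2 + 1) * \<psi> f t) /\<^sub>R t - k1 * ((\<psi> f t - (k1 + 1) * X f t) /\<^sub>R t))) (at t)"
      by (simp only: vv_def[abs_def])
    moreover have "Re ((of_real (f t) - (k2 + 1) * \<psi> f t) /\<^sub>R t - k1 * ((\<psi> f t - (k1 + 1) * X f t) /\<^sub>R t))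
        = (G f t - (1 + b) * vv f t - q * om f t) / t"
    proof -
      have "(of_real (f t) - (k2 + 1) * \<psi> f t) /\<^sub>R t - k1 * ((\<psi> f t - (k1 + 1) * X f t) /\<^sub>R t)
        = ((of_real (f t) - (k2 + 1) * \<psi> f t) - k1 * (\<psi> f t - (k1 + 1) * X f t)) /\<^sub>R t"
        by (simp only: mult_scaleR_right scaleR_diff_right[symmetric])
      \<comment> \<open>Regrouping around \<psi> - k1 X leaves only the sum and the product of the
        roots. Both are real, so taking real parts commutes with these coefficients.\<close>
      also have "(of_real (f t) - (k2 + 1) * \<psi> f t) - k1 * (\<psi> f t - (k1 + 1) * X f t)
        = of_real (G f t) - (1 + (k1 + k2)) * (\<psi> f t - k1 * X f t) - (k1 * k2) * X f t"
        unfolding fG[OF t] by (simp only: ring_distribs) (simp add: algebra_simps)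
      also have "\<dots> = of_real (G f t) - (1 + b) *\<^sub>R (\<psi> f t - k1 * X f t) - q *\<^sub>R X f t"
        unfolding k(1,2) by (simp only: scaleR_conv_of_real of_real_add of_real_1)
      finally show ?thesis
        by (simp only: vv_def om_def scaleR_complex.simps minus_complex.simps Re_complex_of_real
            divide_inverse mult.commute)
    qed
    ultimately show "(vv f has_real_derivative
        (om f t * H (t * om f t) - t * P t * vv f t - (\<alpha> * P t + t * Q t) * (c + t * om f t)
          - (1 + b) * vv f t - q * om f t) / t) (at t)"
      by (simp only: has_real_derivative_iff_has_vector_derivative G_def)
  qed
qed

subsection \<open>Solutions near a singular or vanishing point\<close>

text \<open>The equation is u'' + (a/t + P) u' + (m/t^2 + Q) u = u^p, with the singular coefficients
  separated from the continuous remainders. The terms of order t^(\<alpha>-2) balance exactly when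
  c^p = K c, which determines \<open>c\<close>; the next order is the singular system for
  \<omega>.\<close>

lemma local_solution:
  fixes p \<alpha> a m d :: real and P Q :: "real \<Rightarrow> real"
  assumes p: "0 < p" "p < 1" and \<alpha>: "\<alpha> = 2 / (1 - p)" and a: "0 \<le> a"
    and K: "0 < \<alpha> * (\<alpha> - 1) + \<alpha> * a + m"
    and c: "c = (\<alpha> * (\<alpha> - 1) + \<alpha> * a + m) powr (1 / (p - 1))"
    and d: "0 < d" and P: "continuous_on {0..d} P" and Q: "continuous_on {0..d} Q"
  obtains \<epsilon> \<omega> y where "0 < \<epsilon>" "\<epsilon> \<le> d" "continuous_on UNIV \<omega>" "continuous_on UNIV y"
    "\<And>t. 0 < t \<Longrightarrow> t < \<epsilon> \<Longrightarrow> 0 < c + t * \<omega> t"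
    "\<And>t. 0 < t \<Longrightarrow> t < \<epsilon> \<Longrightarrow>
      ((\<lambda>t. t powr \<alpha> * (c + t * \<omega> t)) has_real_derivative t powr (\<alpha> - 1) * y t) (at t)"
    "\<And>t. 0 < t \<Longrightarrow> t < \<epsilon> \<Longrightarrow>
      ((\<lambda>t. t powr (\<alpha> - 1) * y t) has_real_derivative
        (t powr \<alpha> * (c + t * \<omega> t)) powr p - (a / t + P t) * (t powr (\<alpha> - 1) * y t)
        - (m / t\<^sup>2 + Q t) * (t powr \<alpha> * (c + t * \<omega> t))) (at t)"
proof -
  define K where "K = \<alpha> * (\<alpha> - 1) + \<alpha> * a + m"
  have K0: "0 < K" using K by (simp add: K_def)
  \<comment> \<open>The second identity makes u^p of the same order t^(\<alpha>-2) as u''.\<close>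
  have \<alpha>2: "2 < \<alpha>" "\<alpha> * p = \<alpha> - 2" using p by (auto simp: \<alpha> field_simps)
  have c0: "0 < c" using K0 by (simp add: c K_def)
  have cK: "c powr (p - 1) = K" using K0 p by (simp add: c powr_powr flip: K_def)
  have cp: "c powr p = K * c"
    using powr_add[of c "p - 1" 1] c0 cK by simp
  \<comment> \<open>This is the first-order Taylor remainder of z^p at \<open>c\<close>, since c^p =
    K c and p c^(p-1) = p K.\<close>
  define g where "g x = (c + x) powr p - K * c - p * K * x" for x
  define g' where "g' x = p * (c + x) powr (p - 1) - p * K" for x
  have "(g has_real_derivative g' x) (at x)" if "\<bar>x\<bar> < c" for x
    unfolding g_def g'_def using that by (auto intro!: derivative_eq_intros)
  moreover have "isCont g' 0" unfolding g'_def using c0 by (intro continuous_intros) auto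
  moreover have "g 0 = 0" "g' 0 = 0" by (auto simp: g_def g'_def cK cp)
  ultimately obtain \<eta> H where \<eta>: "0 < \<eta>" and H: "continuous_on UNIV H" "H 0 = 0"
    "\<And>x. \<bar>x\<bar> \<le> \<eta> \<Longrightarrow> g x = x * H x"
    "\<And>x y. \<bar>x * H x - y * H y\<bar> \<le> 1 / 4 * \<bar>x - y\<bar>"
    using superlinear_extension[OF c0, of g g' "1 / 4"] by auto
  have H4: "\<bar>x * H x - y * H y\<bar> \<le> \<bar>x - y\<bar> / 4" for x y using H(4)[of x y] by simp
  define cl where "cl t = max 0 (min d t)" for t
  have ccl: "continuous_on UNIV cl" unfolding cl_def by (intro continuous_intros)
  have cl: "cl ` UNIV \<subseteq> {0..d}" using d by (auto simp: cl_def)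
  note cP = continuous_on_compose2[OF P ccl cl] and cQ = continuous_on_compose2[OF Q ccl cl]
  \<comment> \<open>Dividing by t^(\<alpha>-2), the factor of t v is (\<alpha> - 1) + \<alpha> + 1 +
    a = 1 + b. Moving the linear part p K of the power to the left changes the factor K of t
    \<omega> into \<open>q\<close>.\<close>
  define b where "b = 2 * \<alpha> - 1 + a"
  define q where "q = (1 - p) * K"
  have b0: "0 < b" and q0: "0 < q" using \<alpha>2 a p K0 by (auto simp: b_def q_def)
  obtain \<epsilon>1 \<omega> v where \<epsilon>1: "0 < \<epsilon>1" "\<epsilon>1 \<le> d" and cont: "continuous_on UNIV \<omega>" "continuous_on UNIV v"
    and d\<omega>: "\<And>t. 0 < t \<Longrightarrow> t < \<epsilon>1 \<Longrightarrow> (\<omega> has_real_derivative (v t - \<omega> t) / t) (at t)"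
    and dv: "\<And>t. 0 < t \<Longrightarrow> t < \<epsilon>1 \<Longrightarrow> (v has_real_derivative
        (\<omega> t * H (t * \<omega> t) - t * P (cl t) * v t - (\<alpha> * P (cl t) + t * Q (cl t)) * (c + t * \<omega> t)
          - (1 + b) * v t - q * \<omega> t) / t) (at t)"
    using singular_system_solution[OF b0 q0 d cP cQ H(1,2) H4, of \<alpha> c] by blast
  have "isCont (\<lambda>t. t * \<omega> t) 0"
    using cont(1) by (intro continuous_intros) (simp add: continuous_on_eq_continuous_at)
  moreover have "0 < min \<eta> c" using \<eta> c0 by simp
  \<comment> \<open>The bound \<eta> keeps t \<omega>(t) where the cut-off is inactive, and the
    bound \<open>c\<close> keeps u positive.\<close>
  ultimately obtain e where "0 < e"
    and "\<forall>t. \<bar>t - 0\<bar> < e \<longrightarrow> \<bar>t * \<omega> t - 0 * \<omega> 0\<bar> < min \<eta> c"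
    unfolding continuous_at_real_range real_norm_def by meson
  then have e: "0 < e" "\<And>t. \<bar>t\<bar> < e \<Longrightarrow> \<bar>t * \<omega> t\<bar> < min \<eta> c" by auto
  define \<epsilon> where "\<epsilon> = min \<epsilon>1 e"
  \<comment> \<open>From u' = t^(\<alpha>-1) (\<alpha> (c + t \<omega>) + t (\<theta> + 1)
    \<omega>).\<close>
  define y where "y t = \<alpha> * (c + t * \<omega> t) + t * v t" for t
  show ?thesis
  proof (rule that)
    show "0 < \<epsilon>" "\<epsilon> \<le> d" using \<epsilon>1 e by (auto simp: \<epsilon>_def)
    show "continuous_on UNIV \<omega>" by fact
    show "continuous_on UNIV y" unfolding y_def by (intro continuous_intros cont)
    fix t assume "0 < t" "t < \<epsilon>"
    then have t: "0 < t" "t < \<epsilon>1" "\<bar>t\<bar> < e" "t < d" using \<epsilon>1 by (auto simp: \<epsilon>_def)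
    define V where "V = (\<omega> t * H (t * \<omega> t) - t * P t * v t - (\<alpha> * P t + t * Q t) * (c + t * \<omega> t)
          - (1 + b) * v t - q * \<omega> t) / t"
    have dv': "(v has_real_derivative V) (at t)"
      using dv[OF t(1,2)] t by (simp add: cl_def V_def)
    note d\<omega>' = d\<omega>[OF t(1,2)]
    show pos: "0 < c + t * \<omega> t" using e(2)[OF t(3)] by auto
    have gw: "(c + t * \<omega> t) powr p = t * (\<omega> t * H (t * \<omega> t)) + K * c + p * K * (t * \<omega> t)"
      using H(3)[of "t * \<omega> t"] e(2)[OF t(3)] by (auto simp: g_def)
    define E where "E = t powr (\<alpha> - 2)"
    have E1: "t powr (\<alpha> - 1) = E * t"
      unfolding E_def using t powr_add[of t "\<alpha> - 2" 1] by simp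
    have E2: "t powr \<alpha> = E * t\<^sup>2"
      unfolding E_def using t powr_add[of t "\<alpha> - 2" 2] by simp
    have Ep: "(t powr \<alpha> * (c + t * \<omega> t)) powr p = E * (c + t * \<omega> t) powr p"
      unfolding E_def using t pos \<alpha>2 by (simp add: powr_mult powr_powr)
    show "((\<lambda>t. t powr \<alpha> * (c + t * \<omega> t)) has_real_derivative t powr (\<alpha> - 1) * y t) (at t)"
      using t by (auto intro!: derivative_eq_intros d\<omega>' simp: y_def E1 E2 power2_eq_square field_simps)
    have "((\<lambda>t. t powr (\<alpha> - 1) * y t) has_real_derivative
        (\<alpha> - 1) * t powr (\<alpha> - 2) * y t
        + t powr (\<alpha> - 1) * (\<alpha> * (\<omega> t + t * ((v t - \<omega> t) / t)) + (v t + t * V))) (at t)"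
      unfolding y_def using t by (auto intro!: derivative_eq_intros d\<omega>' dv' simp: algebra_simps)
    also have "(\<alpha> - 1) * t powr (\<alpha> - 2) * y t
        + t powr (\<alpha> - 1) * (\<alpha> * (\<omega> t + t * ((v t - \<omega> t) / t)) + (v t + t * V))
      = E * ((\<alpha> - 1) * y t + t * (\<alpha> * v t + v t + t * V))"
      using t by (simp add: E1 flip: E_def) (simp add: algebra_simps)
    also have "t * V = \<omega> t * H (t * \<omega> t) - t * P t * v t - (\<alpha> * P t + t * Q t) * (c + t * \<omega> t)
          - (1 + b) * v t - q * \<omega> t"
      using t by (simp add: V_def)
    also have "E * ((\<alpha> - 1) * y t + t * (\<alpha> * v t + v t + (\<omega> t * H (t * \<omega> t) - t * P t * v t
          - (\<alpha> * P t + t * Q t) * (c + t * \<omega> t) - (1 + b) * v t - q * \<omega> t)))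
      = E * ((c + t * \<omega> t) powr p - (a + t * P t) * y t - (m + t\<^sup>2 * Q t) * (c + t * \<omega> t))"
      unfolding gw b_def q_def y_def K_def by (simp add: algebra_simps power2_eq_square)
    also have "\<dots> = (t powr \<alpha> * (c + t * \<omega> t)) powr p - (a / t + P t) * (t powr (\<alpha> - 1) * y t)
        - (m / t\<^sup>2 + Q t) * (t powr \<alpha> * (c + t * \<omega> t))"
      unfolding Ep unfolding E1 E2 using t by (simp add: field_simps power2_eq_square)
    finally show "((\<lambda>t. t powr (\<alpha> - 1) * y t) has_real_derivative
        (t powr \<alpha> * (c + t * \<omega> t)) powr p - (a / t + P t) * (t powr (\<alpha> - 1) * y t)
        - (m / t\<^sup>2 + Q t) * (t powr \<alpha> * (c + t * \<omega> t))) (at t)" .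
  qed
qed

section \<open>Regularity at the zero and verification of the equation\<close>

text \<open>The difference quotient is bounded by a positive power of the distance. Applied to u and
  to u', this supplies their derivatives at \<open>R0\<close>, where the formulas for the branches
  do not apply.\<close>

lemma has_real_derivative_zero_powr:
  fixes f h :: "real \<Rightarrow> real"
  assumes \<beta>: "1 < \<beta>" and e: "0 < e" and f0: "f x0 = 0"
    and B: "\<And>x. x \<in> S \<Longrightarrow> \<bar>x - x0\<bar> < e \<Longrightarrow> \<bar>f x\<bar> \<le> B * \<bar>x - x0\<bar> powr \<beta>"
  shows "(f has_real_derivative 0) (at x0 within S)"
proof -
  have "((\<lambda>x. B * \<bar>x - x0\<bar> powr (\<beta> - 1)) \<longlongrightarrow> B * \<bar>x0 - x0\<bar> powr (\<beta> - 1)) (at x0 within S)"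
    using \<beta> by (intro tendsto_intros) auto
  then have "((\<lambda>x. B * \<bar>x - x0\<bar> powr (\<beta> - 1)) \<longlongrightarrow> 0) (at x0 within S)" by simp
  moreover have "eventually (\<lambda>x. norm ((f x - f x0) / (x - x0)) \<le> B * \<bar>x - x0\<bar> powr (\<beta> - 1)) (at x0 within S)"
    unfolding eventually_at
  proof (intro exI[of _ e] conjI ballI impI)
    fix x assume x: "x \<in> S" "x \<noteq> x0 \<and> dist x x0 < e"
    have "\<bar>x - x0\<bar> powr \<beta> = \<bar>x - x0\<bar> powr (\<beta> - 1) * \<bar>x - x0\<bar>"
      using x powr_add[of "\<bar>x - x0\<bar>" "\<beta> - 1" 1] by simp
    then show "norm ((f x - f x0) / (x - x0)) \<le> B * \<bar>x - x0\<bar> powr (\<beta> - 1)"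
      using B[of x] x f0 by (auto simp: dist_real_def abs_divide field_simps)
  qed fact
  ultimately have "((\<lambda>x. (f x - f x0) / (x - x0)) \<longlongrightarrow> 0) (at x0 within S)"
    by (rule Lim_null_comparison[rotated])
  then show ?thesis by (simp add: has_field_derivative_iff)
qed

text \<open>The second derivative is taken to be what the equation prescribes; its continuity then
  follows from that of u, u' and \<delta>.\<close>

lemma radial_solution_onI:
  assumes p: "0 < p" and \<delta>: "continuous_on I \<delta>" "\<And>r. r \<in> I \<Longrightarrow> r \<noteq> 0 \<and> \<delta> r \<noteq> 0"
    and u0: "\<And>r. r \<in> I \<Longrightarrow> 0 \<le> u r"
    and du: "\<And>r. r \<in> I \<Longrightarrow> (u has_real_derivative u' r) (at r)"
    and du': "\<And>r. r \<in> I \<Longrightarrow> (u' has_real_derivative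
        u r powr p - (real N - 1) / r * u' r - \<mu> / (\<delta> r)\<^sup>2 * u r) (at r)"
  shows "radial_solution_on I N p \<mu> \<delta> u"
proof -
  have "continuous_on I u" "continuous_on I u'"
    using DERIV_continuous_on[OF has_field_derivative_at_within[OF du]]
      DERIV_continuous_on[OF has_field_derivative_at_within[OF du']] by auto
  then have "continuous_on I (\<lambda>r. u r powr p - (real N - 1) / r * u' r - \<mu> / (\<delta> r)\<^sup>2 * u r)"
    using \<delta> p u0 by (intro continuous_intros continuous_on_powr') auto
  then show ?thesis
    unfolding radial_solution_on_def using u0 du du'
    by (intro exI[of _ u'] exI[of _ "\<lambda>r. u r powr p - (real N - 1) / r * u' r - \<mu> / (\<delta> r)\<^sup>2 * u r"]) auto
qed

text \<open>With \<alpha> = 2/(1-p) this is \<alpha> (\<alpha> - 1), the factor produced by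
  differentiating t^\<alpha> twice.\<close>

lemma mu_star_eq:
  assumes "p < 1"
  shows "mu_star p = 2 / (1 - p) * (2 / (1 - p) - 1)"
  using assms by (simp add: mu_star_def field_simps power2_eq_square)

text \<open>The branch \<open>u = \<bar>r - R0\<bar>\<^sup>\<alpha> (c + W \<bar>r - R0\<bar>)\<close> on the side of \<open>R0\<close> given by the sign \<open>\<sigma>\<close>;
  \<open>Y\<close> describes its first derivative.\<close>

definition branch_solution ::
    "nat \<Rightarrow> real \<Rightarrow> real \<Rightarrow> (real \<Rightarrow> real) \<Rightarrow> real \<Rightarrow> real \<Rightarrow> real \<Rightarrow> real \<Rightarrow> (real \<Rightarrow> real) \<Rightarrow> (real \<Rightarrow> real) \<Rightarrow> bool"
  where "branch_solution N p \<mu> \<delta> c R0 \<sigma> \<epsilon> W Y \<longleftrightarrow>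
    continuous_on UNIV W \<and> continuous_on UNIV Y \<and> W 0 = 0 \<and>
    (\<forall>r. 0 < \<sigma> * (r - R0) \<and> \<sigma> * (r - R0) < \<epsilon> \<longrightarrow>
      0 < c + W \<bar>r - R0\<bar> \<and>
      ((\<lambda>r. \<bar>r - R0\<bar> powr (2 / (1 - p)) * (c + W \<bar>r - R0\<bar>)) has_real_derivative
        \<bar>r - R0\<bar> powr (2 / (1 - p) - 1) * (\<sigma> * Y \<bar>r - R0\<bar>)) (at r) \<and>
      ((\<lambda>r. \<bar>r - R0\<bar> powr (2 / (1 - p) - 1) * (\<sigma> * Y \<bar>r - R0\<bar>)) has_real_derivative
        (\<bar>r - R0\<bar> powr (2 / (1 - p)) * (c + W \<bar>r - R0\<bar>)) powr p
        - (real N - 1) / r * (\<bar>r - R0\<bar> powr (2 / (1 - p) - 1) * (\<sigma> * Y \<bar>r - R0\<bar>))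
        - \<mu> / (\<delta> r)\<^sup>2 * (\<bar>r - R0\<bar> powr (2 / (1 - p)) * (c + W \<bar>r - R0\<bar>))) (at r))"

lemma branch_solution_mono:
  "branch_solution N p \<mu> \<delta> c R0 \<sigma> \<epsilon> W Y \<Longrightarrow> \<epsilon>' \<le> \<epsilon> \<Longrightarrow> branch_solution N p \<mu> \<delta> c R0 \<sigma> \<epsilon>' W Y"
  unfolding branch_solution_def by fastforce

text \<open>Since \<open>R0\<close> and the nearby radii are positive, (N-1)/r is regular and goes
  entirely into \<open>P\<close>, so a = 0. The parameter \<open>m\<close> is the inverse-square
  part of the potential at \<open>R0\<close>.\<close>

lemma branch_solution_exists:
  assumes p: "0 < p" "p < 1" and \<sigma>: "\<sigma> = 1 \<or> \<sigma> = - 1" and d: "0 < d" and m: "0 < mu_star p + m"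
    and pos: "\<And>t. 0 \<le> t \<Longrightarrow> t \<le> d \<Longrightarrow> 0 < R0 + \<sigma> * t"
    and Q: "continuous_on {0..d} Q"
    and \<delta>: "\<And>t. 0 < t \<Longrightarrow> t < d \<Longrightarrow> \<mu> / (\<delta> (R0 + \<sigma> * t))\<^sup>2 = m / t\<^sup>2 + Q t"
  obtains \<epsilon> W Y where "0 < \<epsilon>" "\<epsilon> \<le> d"
    "branch_solution N p \<mu> \<delta> ((mu_star p + m) powr (1 / (p - 1))) R0 \<sigma> \<epsilon> W Y"
proof -
  define \<alpha> where "\<alpha> = 2 / (1 - p)"
  define c where "c = (mu_star p + m) powr (1 / (p - 1))"
  \<comment> \<open>With r = R0 + \<sigma> t, a first derivative in r gains the factor \<sigma> and
    a second one \<sigma>^2 = 1, so only the first-order coefficient changes sign.\<close>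
  define P where "P t = \<sigma> * ((real N - 1) / (R0 + \<sigma> * t))" for t
  have P: "continuous_on {0..d} P"
  proof -
    have "R0 + \<sigma> * t \<noteq> 0" if "0 \<le> t" "t \<le> d" for t using pos[OF that] by simp
    then show ?thesis unfolding P_def by (intro continuous_intros) auto
  qed
  have K: "0 < \<alpha> * (\<alpha> - 1) + \<alpha> * 0 + m" "c = (\<alpha> * (\<alpha> - 1) + \<alpha> * 0 + m) powr (1 / (p - 1))"
    using m p by (simp_all add: c_def mu_star_eq \<alpha>_def)
  obtain \<epsilon> \<omega> y where \<epsilon>: "0 < \<epsilon>" "\<epsilon> \<le> d" and cont: "continuous_on UNIV \<omega>" "continuous_on UNIV y"
    and c0: "\<And>t. 0 < t \<Longrightarrow> t < \<epsilon> \<Longrightarrow> 0 < c + t * \<omega> t"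
    and dU: "\<And>t. 0 < t \<Longrightarrow> t < \<epsilon> \<Longrightarrow>
      ((\<lambda>t. t powr \<alpha> * (c + t * \<omega> t)) has_real_derivative t powr (\<alpha> - 1) * y t) (at t)"
    and dU': "\<And>t. 0 < t \<Longrightarrow> t < \<epsilon> \<Longrightarrow>
      ((\<lambda>t. t powr (\<alpha> - 1) * y t) has_real_derivative
        (t powr \<alpha> * (c + t * \<omega> t)) powr p - (0 / t + P t) * (t powr (\<alpha> - 1) * y t)
        - (m / t\<^sup>2 + Q t) * (t powr \<alpha> * (c + t * \<omega> t))) (at t)"
    using local_solution[OF p \<alpha>_def order_refl K d P Q] by blast
  have "branch_solution N p \<mu> \<delta> c R0 \<sigma> \<epsilon> (\<lambda>t. t * \<omega> t) y"
    unfolding branch_solution_def \<alpha>_def[symmetric]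
  proof (intro conjI allI impI)
    show "continuous_on UNIV (\<lambda>t. t * \<omega> t)" "continuous_on UNIV y"
      by (intro continuous_intros cont)+
    fix r assume r: "0 < \<sigma> * (r - R0) \<and> \<sigma> * (r - R0) < \<epsilon>"
    then have t: "0 < \<bar>r - R0\<bar>" "\<bar>r - R0\<bar> < \<epsilon>" "r = R0 + \<sigma> * \<bar>r - R0\<bar>"
      using \<sigma> by auto
    define t where "t = \<bar>r - R0\<bar>"
    have tr: "0 < t" "t < \<epsilon>" "t < d" and rt: "R0 + \<sigma> * t = r" using t \<epsilon> by (auto simp: t_def)
    have \<sigma>2: "\<sigma> * \<sigma> = 1" using \<sigma> by auto
    have "((\<lambda>r. \<sigma> * (r - R0)) has_real_derivative \<sigma>) (at r)"
      by (auto intro!: derivative_eq_intros)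
    \<comment> \<open>On the open half-line selected by \<sigma> the modulus is the linear function
      \<sigma> (r - R0).\<close>
    then have dabs: "((\<lambda>r. \<bar>r - R0\<bar>) has_real_derivative \<sigma>) (at r)"
    proof (rule has_field_derivative_transform_within_open)
      show "open {s. 0 < \<sigma> * (s - R0)}" by (intro open_Collect_less continuous_intros)
      show "r \<in> {s. 0 < \<sigma> * (s - R0)}" using r by simp
      show "\<sigma> * (s - R0) = \<bar>s - R0\<bar>" if "s \<in> {s. 0 < \<sigma> * (s - R0)}" for s
        using that \<sigma> by auto
    qed
    show "0 < c + \<bar>r - R0\<bar> * \<omega> \<bar>r - R0\<bar>" using c0 t by simp
    show "((\<lambda>r. \<bar>r - R0\<bar> powr \<alpha> * (c + \<bar>r - R0\<bar> * \<omega> \<bar>r - R0\<bar>)) has_real_derivative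
        \<bar>r - R0\<bar> powr (\<alpha> - 1) * (\<sigma> * y \<bar>r - R0\<bar>)) (at r)"
      using DERIV_chain2[where f="\<lambda>t. t powr \<alpha> * (c + t * \<omega> t)", OF dU[OF t(1,2)] dabs]
      by (simp only: mult.assoc mult.commute[of "y _"])
    have "((\<lambda>r. \<bar>r - R0\<bar> powr (\<alpha> - 1) * y \<bar>r - R0\<bar>) has_real_derivative
        ((t powr \<alpha> * (c + t * \<omega> t)) powr p - (0 / t + P t) * (t powr (\<alpha> - 1) * y t)
        - (m / t\<^sup>2 + Q t) * (t powr \<alpha> * (c + t * \<omega> t))) * \<sigma>) (at r)"
      using DERIV_chain2[where f="\<lambda>t. t powr (\<alpha> - 1) * y t", OF dU'[OF t(1,2)] dabs]
      by (simp only: t_def)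
    from DERIV_cmult[OF this, of \<sigma>]
    have "((\<lambda>r. \<bar>r - R0\<bar> powr (\<alpha> - 1) * (\<sigma> * y \<bar>r - R0\<bar>)) has_real_derivative
        \<sigma> * (((t powr \<alpha> * (c + t * \<omega> t)) powr p - (0 / t + P t) * (t powr (\<alpha> - 1) * y t)
        - (m / t\<^sup>2 + Q t) * (t powr \<alpha> * (c + t * \<omega> t))) * \<sigma>)) (at r)"
      by (simp only: mult.left_commute)
    also have "\<sigma> * (((t powr \<alpha> * (c + t * \<omega> t)) powr p - (0 / t + P t) * (t powr (\<alpha> - 1) * y t)
        - (m / t\<^sup>2 + Q t) * (t powr \<alpha> * (c + t * \<omega> t))) * \<sigma>)
      = (\<sigma> * \<sigma>) * ((t powr \<alpha> * (c + t * \<omega> t)) powr p - (0 / t + P t) * (t powr (\<alpha> - 1) * y t)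
        - (m / t\<^sup>2 + Q t) * (t powr \<alpha> * (c + t * \<omega> t)))"
      by (simp only: mult_ac)
    also have "\<dots> = (t powr \<alpha> * (c + t * \<omega> t)) powr p - (real N - 1) / r * (t powr (\<alpha> - 1) * (\<sigma> * y t))
        - \<mu> / (\<delta> r)\<^sup>2 * (t powr \<alpha> * (c + t * \<omega> t))"
      using \<delta>[OF tr(1,3)] by (simp add: \<sigma>2 P_def rt)
    finally show "((\<lambda>r. \<bar>r - R0\<bar> powr (\<alpha> - 1) * (\<sigma> * y \<bar>r - R0\<bar>)) has_real_derivative
        (\<bar>r - R0\<bar> powr \<alpha> * (c + \<bar>r - R0\<bar> * \<omega> \<bar>r - R0\<bar>)) powr p
        - (real N - 1) / r * (\<bar>r - R0\<bar> powr (\<alpha> - 1) * (\<sigma> * y \<bar>r - R0\<bar>))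
        - \<mu> / (\<delta> r)\<^sup>2 * (\<bar>r - R0\<bar> powr \<alpha> * (c + \<bar>r - R0\<bar> * \<omega> \<bar>r - R0\<bar>))) (at r)"
      by (simp only: t_def)
  qed simp
  with \<epsilon> show ?thesis by (intro that[of \<epsilon> "\<lambda>t. t * \<omega> t" y]) (simp_all add: c_def)
qed

section \<open>Solutions vanishing at a positive radius\<close>

lemma continuous_bounded_by:
  fixes f :: "real \<Rightarrow> real"
  assumes "continuous_on UNIV f"
  obtains B where "\<And>t. 0 \<le> t \<Longrightarrow> t \<le> e \<Longrightarrow> \<bar>f t\<bar> \<le> B"
proof -
  have "bounded (f ` {0..e})"
    by (intro compact_imp_bounded compact_continuous_image continuous_on_subset[OF assms]) auto
  then obtain B where "\<forall>t\<in>{0..e}. \<bar>f t\<bar> \<le> B" by (auto simp: bounded_iff)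
  then show ?thesis by (intro that[of B]) auto
qed

text \<open>Away from \<open>R0\<close> everything is assumed. At \<open>R0\<close> the exponents
  \<alpha> > 2 and \<alpha> - 1 > 1 force u' and u'' to vanish, so the equation reads 0 = 0 there if
  \<open>R0\<close> lies in \<open>D\<close>.\<close>

lemma vanishing_solutionI:
  fixes w y :: "real \<Rightarrow> real"
  assumes p: "0 < p" "p < 1" and R0: "R0 \<in> J" and JD: "J - {R0} \<subseteq> D" and J: "R0 \<in> D \<Longrightarrow> open J"
    and D: "\<And>r. r \<in> D \<Longrightarrow> 0 < r \<and> \<delta> r \<noteq> 0" "continuous_on D \<delta>"
    and w: "continuous_on ((\<lambda>r. r - R0) ` J) w" "w 0 = 0"
    and B: "\<And>r. r \<in> J \<Longrightarrow> \<bar>c + w (r - R0)\<bar> \<le> B" "\<And>r. r \<in> J \<Longrightarrow> \<bar>y (r - R0)\<bar> \<le> B"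
    and pos: "\<And>r. r \<in> J \<Longrightarrow> r \<noteq> R0 \<Longrightarrow> 0 < c + w (r - R0)"
    and u: "\<And>r. u r = \<bar>r - R0\<bar> powr (2 / (1 - p)) * (c + w (r - R0))"
    and u': "\<And>r. u' r = \<bar>r - R0\<bar> powr (2 / (1 - p) - 1) * y (r - R0)"
    and du: "\<And>r. r \<in> J \<Longrightarrow> r \<noteq> R0 \<Longrightarrow> (u has_real_derivative u' r) (at r)"
    and du': "\<And>r. r \<in> J \<Longrightarrow> r \<noteq> R0 \<Longrightarrow> (u' has_real_derivative
        u r powr p - (real N - 1) / r * u' r - \<mu> / (\<delta> r)\<^sup>2 * u r) (at r)"
  shows "vanishing_solution D N p \<mu> \<delta> c R0 J"
proof -
  have \<alpha>: "2 < 2 / (1 - p)" using p by (simp add: field_simps)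
  have u0: "u R0 = 0" "u' R0 = 0" by (simp_all add: u u')
  have d0: "(u has_real_derivative 0) (at R0 within J)"
    by (rule has_real_derivative_zero_powr[where \<beta>="2 / (1 - p)" and e=1 and B=B])
      (use \<alpha> u0 B in \<open>auto simp: u abs_mult mult.commute intro!: mult_right_mono\<close>)
  have d0': "(u' has_real_derivative 0) (at R0 within J)"
    by (rule has_real_derivative_zero_powr[where \<beta>="2 / (1 - p) - 1" and e=1 and B=B])
      (use \<alpha> u0 B in \<open>auto simp: u' abs_mult mult.commute intro!: mult_right_mono\<close>)
  have "radial_solution_on (J \<inter> D) N p \<mu> \<delta> u"
  proof (rule radial_solution_onI[OF p(1), where u'=u'])
    show "continuous_on (J \<inter> D) \<delta>" using D(2) by (rule continuous_on_subset) auto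
    fix r assume r: "r \<in> J \<inter> D"
    show "r \<noteq> 0 \<and> \<delta> r \<noteq> 0" using D(1)[of r] r by auto
    show "0 \<le> u r" using pos[of r] r by (cases "r = R0") (auto simp: u)
    \<comment> \<open>For \<open>r = R0\<close> in \<open>D\<close> the set \<open>J\<close> is
      open, so the derivative relative to \<open>J\<close> is a full derivative.\<close>
    show "(u has_real_derivative u' r) (at r)"
      using du[of r] r d0 u0 J at_within_open[of R0 J] by (cases "r = R0") auto
    show "(u' has_real_derivative
        u r powr p - (real N - 1) / r * u' r - \<mu> / (\<delta> r)\<^sup>2 * u r) (at r)"
      using du'[of r] r d0' u0 p J at_within_open[of R0 J] by (cases "r = R0") auto
  qed
  moreover have "0 < u r" if "r \<in> J - {R0}" for r
    using pos[of r] that by (auto simp: u)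
  ultimately show ?thesis
    unfolding vanishing_solution_def using JD d0 w u0
    by (intro conjI exI[of _ u] exI[of _ w]) (auto simp: u)
qed

text \<open>Here \<delta> equals the distance t to \<open>R0\<close>, so the potential is purely
  inverse-square: m = \<mu> and Q = 0. The hypothesis on \<mu> is the positivity of the constant
  K.\<close>

lemma vanishing_solution_boundary:
  assumes p: "0 < p" "p < 1" and \<sigma>: "\<sigma> = 1 \<or> \<sigma> = - 1" and d: "0 < d" and m: "0 < mu_star p + \<mu>"
    and R0: "0 < R0" "R0 \<notin> D" and pos: "0 < R0 + \<sigma> * d"
    and D: "\<And>r. r \<in> D \<Longrightarrow> 0 < r \<and> \<delta> r \<noteq> 0" "continuous_on D \<delta>"
    and inD: "\<And>t. 0 < t \<Longrightarrow> t < d \<Longrightarrow> R0 + \<sigma> * t \<in> D \<and> \<delta> (R0 + \<sigma> * t) = t"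
  shows "\<exists>\<epsilon>>0. vanishing_solution D N p \<mu> \<delta> ((mu_star p + \<mu>) powr (1 / (p - 1))) R0
           {r. 0 \<le> \<sigma> * (r - R0) \<and> \<sigma> * (r - R0) < \<epsilon>}"
proof -
  define c where "c = (mu_star p + \<mu>) powr (1 / (p - 1))"
  have pos': "0 < R0 + \<sigma> * t" if "0 \<le> t" "t \<le> d" for t using \<sigma> R0 pos that by auto
  obtain \<epsilon> W Y where \<epsilon>: "0 < \<epsilon>" "\<epsilon> \<le> d" and br: "branch_solution N p \<mu> \<delta> c R0 \<sigma> \<epsilon> W Y"
    using branch_solution_exists[where Q="\<lambda>_. 0" and \<delta>=\<delta> and N=N and \<mu>=\<mu>, OF p \<sigma> d m pos'] inD
    unfolding c_def by auto
  note br = br[unfolded branch_solution_def]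
  have W: "continuous_on UNIV W" "continuous_on UNIV Y" "W 0 = 0" using br by blast+
  have "continuous_on UNIV (\<lambda>t. \<bar>c + W t\<bar> + \<bar>Y t\<bar>)" by (intro continuous_intros W)
  from continuous_bounded_by[OF this, of \<epsilon>] obtain B
    where B: "\<And>t. 0 \<le> t \<Longrightarrow> t \<le> \<epsilon> \<Longrightarrow> \<bar>c + W t\<bar> + \<bar>Y t\<bar> \<le> B" by auto
  define J where "J = {r. 0 \<le> \<sigma> * (r - R0) \<and> \<sigma> * (r - R0) < \<epsilon>}"
  have J: "0 < \<sigma> * (r - R0) \<and> \<sigma> * (r - R0) < \<epsilon>" if "r \<in> J" "r \<noteq> R0" for r
    using that \<sigma> by (auto simp: J_def)
  have Jb: "\<bar>c + W \<bar>r - R0\<bar>\<bar> + \<bar>Y \<bar>r - R0\<bar>\<bar> \<le> B" if "r \<in> J" for r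
    using that \<sigma> by (intro B) (auto simp: J_def)
  have "vanishing_solution D N p \<mu> \<delta> c R0 J"
  proof (rule vanishing_solutionI[OF p, where w="\<lambda>x. W \<bar>x\<bar>" and y="\<lambda>x. \<sigma> * Y \<bar>x\<bar>" and B=B
        and u="\<lambda>r. \<bar>r - R0\<bar> powr (2 / (1 - p)) * (c + W \<bar>r - R0\<bar>)"
        and u'="\<lambda>r. \<bar>r - R0\<bar> powr (2 / (1 - p) - 1) * (\<sigma> * Y \<bar>r - R0\<bar>)"])
    show "R0 \<in> J" using \<epsilon> by (simp add: J_def)
    show "J - {R0} \<subseteq> D"
    proof
      fix r assume "r \<in> J - {R0}"
      then have "0 < \<bar>r - R0\<bar>" "\<bar>r - R0\<bar> < d" "r = R0 + \<sigma> * \<bar>r - R0\<bar>"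
        using J[of r] \<epsilon> \<sigma> by auto
      then show "r \<in> D" using inD by metis
    qed
    show "open J" if "R0 \<in> D" using that R0 by simp
    show "continuous_on ((\<lambda>r. r - R0) ` J) (\<lambda>x. W \<bar>x\<bar>)"
      by (intro continuous_on_compose2[OF W(1)] continuous_intros) auto
    show "\<bar>\<sigma> * Y \<bar>r - R0\<bar>\<bar> \<le> B" if "r \<in> J" for r
      using Jb[OF that] \<sigma> by (auto simp: abs_mult)
    show "\<bar>c + W \<bar>r - R0\<bar>\<bar> \<le> B" if "r \<in> J" for r
      using Jb[OF that] by linarith
    show "W \<bar>0\<bar> = 0" by (simp add: W)
    fix r assume r: "r \<in> J" "r \<noteq> R0"
    note b = br[THEN conjunct2, THEN conjunct2, THEN conjunct2, rule_format, OF J[OF r]]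
    show "0 < c + W \<bar>r - R0\<bar>" by (rule b[THEN conjunct1])
    show "((\<lambda>r. \<bar>r - R0\<bar> powr (2 / (1 - p)) * (c + W \<bar>r - R0\<bar>)) has_real_derivative
        \<bar>r - R0\<bar> powr (2 / (1 - p) - 1) * (\<sigma> * Y \<bar>r - R0\<bar>)) (at r)"
      by (rule b[THEN conjunct2, THEN conjunct1])
    show "((\<lambda>r. \<bar>r - R0\<bar> powr (2 / (1 - p) - 1) * (\<sigma> * Y \<bar>r - R0\<bar>)) has_real_derivative
        (\<bar>r - R0\<bar> powr (2 / (1 - p)) * (c + W \<bar>r - R0\<bar>)) powr p
        - (real N - 1) / r * (\<bar>r - R0\<bar> powr (2 / (1 - p) - 1) * (\<sigma> * Y \<bar>r - R0\<bar>))
        - \<mu> / (\<delta> r)\<^sup>2 * (\<bar>r - R0\<bar> powr (2 / (1 - p)) * (c + W \<bar>r - R0\<bar>))) (at r)"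
      by (rule b[THEN conjunct2, THEN conjunct2])
  qed (rule D refl; assumption?)+
  then show ?thesis using \<epsilon> unfolding J_def c_def by blast
qed

text \<open>Near an interior point the potential is continuous, so it goes into \<open>Q\<close>
  with m = 0. Both sides get the same \<open>c\<close>; the two branches are built independently and
  fit together because u, u' and u'' vanish at \<open>R0\<close>.\<close>

lemma vanishing_solution_interior:
  assumes p: "0 < p" "p < 1" and R0: "0 \<le> l" "l < R0" "R0 < R"
    and D: "\<And>r. r \<in> {l<..<R} \<Longrightarrow> \<delta> r \<noteq> 0" "continuous_on {l<..<R} \<delta>"
  shows "\<exists>\<epsilon>>0. vanishing_solution {l<..<R} N p \<mu> \<delta> (mu_star p powr (1 / (p - 1))) R0
           {R0-\<epsilon><..<R0+\<epsilon>}"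
proof -
  define c where "c = mu_star p powr (1 / (p - 1))"
  define d where "d = min (R0 - l) (R - R0) / 2"
  have d: "0 < d" "l < R0 - d" "R0 + d < R" using R0 by (auto simp: d_def min_def field_simps)
  have m: "0 < mu_star p + 0" using p by (simp add: mu_star_def)
  have ex: "\<exists>\<epsilon> W Y. 0 < \<epsilon> \<and> \<epsilon> \<le> d \<and> branch_solution N p \<mu> \<delta> c R0 \<sigma> \<epsilon> W Y"
    if \<sigma>: "\<sigma> = 1 \<or> \<sigma> = - 1" for \<sigma>
  proof -
    have inD: "R0 + \<sigma> * t \<in> {l<..<R}" if "0 \<le> t" "t \<le> d" for t using \<sigma> that d by auto
    then have pos: "0 < R0 + \<sigma> * t" if "0 \<le> t" "t \<le> d" for t using that R0 by force
    have "continuous_on {0..d} (\<lambda>t. \<delta> (R0 + \<sigma> * t))"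
      by (rule continuous_on_compose2[OF D(2)]) (use inD in \<open>auto intro!: continuous_intros\<close>)
    then have "continuous_on {0..d} (\<lambda>t. \<mu> / (\<delta> (R0 + \<sigma> * t))\<^sup>2)"
      using inD D(1) by (intro continuous_intros) auto
    moreover have "\<mu> / (\<delta> (R0 + \<sigma> * t))\<^sup>2 = 0 / t\<^sup>2 + \<mu> / (\<delta> (R0 + \<sigma> * t))\<^sup>2" for t
      by simp
    ultimately obtain \<epsilon> W Y where "0 < \<epsilon>" "\<epsilon> \<le> d"
      "branch_solution N p \<mu> \<delta> ((mu_star p + 0) powr (1 / (p - 1))) R0 \<sigma> \<epsilon> W Y"
      using branch_solution_exists[OF p \<sigma> d(1) m pos] by blast
    then show ?thesis by (auto simp: c_def)
  qed
  obtain e1 W1 Y1 e2 W2 Y2 where e: "0 < e1" "e1 \<le> d" "0 < e2" "e2 \<le> d"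
    and b: "branch_solution N p \<mu> \<delta> c R0 1 e1 W1 Y1" "branch_solution N p \<mu> \<delta> c R0 (- 1) e2 W2 Y2"
    using ex[of 1] ex[of "- 1"] by auto
  define \<epsilon> where "\<epsilon> = min e1 e2"
  have \<epsilon>: "0 < \<epsilon>" "\<epsilon> \<le> d" using e by (auto simp: \<epsilon>_def)
  have b1: "branch_solution N p \<mu> \<delta> c R0 1 \<epsilon> W1 Y1" and b2: "branch_solution N p \<mu> \<delta> c R0 (- 1) \<epsilon> W2 Y2"
    using b by (auto elim!: branch_solution_mono simp: \<epsilon>_def)
  note b1 = b1[unfolded branch_solution_def] and b2 = b2[unfolded branch_solution_def]
  have W: "continuous_on UNIV W1" "continuous_on UNIV Y1" "W1 0 = 0"
    "continuous_on UNIV W2" "continuous_on UNIV Y2" "W2 0 = 0" using b1 b2 by blast+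
  have "continuous_on UNIV (\<lambda>t. \<bar>c + W1 t\<bar> + \<bar>Y1 t\<bar> + \<bar>c + W2 t\<bar> + \<bar>Y2 t\<bar>)"
    by (intro continuous_intros W)
  from continuous_bounded_by[OF this, of \<epsilon>] obtain B where B: "\<And>t. 0 \<le> t \<Longrightarrow> t \<le> \<epsilon> \<Longrightarrow>
      \<bar>c + W1 t\<bar> + \<bar>Y1 t\<bar> + \<bar>c + W2 t\<bar> + \<bar>Y2 t\<bar> \<le> B" by auto
  define w where "w x = (if 0 \<le> x then W1 \<bar>x\<bar> else W2 \<bar>x\<bar>)" for x
  \<comment> \<open>The factors \<open>1 *\<close> and \<open>- 1 *\<close> keep the shape \<sigma>
    Y of the branches, so their derivative facts apply verbatim.\<close>
  define y where "y x = (if 0 \<le> x then 1 * Y1 \<bar>x\<bar> else - 1 * Y2 \<bar>x\<bar>)" for x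
  define J where "J = {R0-\<epsilon><..<R0+\<epsilon>}"
  define u where "u r = \<bar>r - R0\<bar> powr (2 / (1 - p)) * (c + w (r - R0))" for r
  define u' where "u' r = \<bar>r - R0\<bar> powr (2 / (1 - p) - 1) * y (r - R0)" for r
  have "vanishing_solution {l<..<R} N p \<mu> \<delta> c R0 J"
  proof (rule vanishing_solutionI[OF p, where w=w and y=y and B=B and u=u and u'=u'])
    show "R0 \<in> J" "J - {R0} \<subseteq> {l<..<R}" "open J" using \<epsilon> d by (auto simp: J_def)
    show "0 < r \<and> \<delta> r \<noteq> 0" if "r \<in> {l<..<R}" for r using that R0 D(1)[of r] by auto
    show "continuous_on {l<..<R} \<delta>" by fact
    show "w 0 = 0" by (simp add: w_def W)
    \<comment> \<open>The two pieces agree at 0 because \<open>W1 0\<close> and \<open>W2 0\<close>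
      are both 0.\<close>
    have "continuous_on ({0..} \<union> {..0}) (\<lambda>x. if 0 \<le> x then W1 \<bar>x\<bar> else W2 \<bar>x\<bar>)"
      by (rule continuous_on_If) (auto simp: W intro!: continuous_on_compose2[OF W(1)]
          continuous_on_compose2[OF W(4)] continuous_intros)
    then show "continuous_on ((\<lambda>r. r - R0) ` J) w"
      unfolding w_def by (rule continuous_on_subset) auto
    show "\<bar>c + w (r - R0)\<bar> \<le> B" "\<bar>y (r - R0)\<bar> \<le> B" if "r \<in> J" for r
    proof -
      have "\<bar>r - R0\<bar> \<le> \<epsilon>" using that by (auto simp: J_def)
      from B[OF abs_ge_zero this] show "\<bar>c + w (r - R0)\<bar> \<le> B" "\<bar>y (r - R0)\<bar> \<le> B"
        by (auto simp: w_def y_def)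
    qed
    fix r assume r: "r \<in> J" "r \<noteq> R0"
    have "0 < c + w (r - R0) \<and> (u has_real_derivative u' r) (at r) \<and>
      (u' has_real_derivative u r powr p - (real N - 1) / r * u' r - \<mu> / (\<delta> r)\<^sup>2 * u r) (at r)"
    proof (cases "R0 < r")
      case True
      have eq: "w (s - R0) = W1 \<bar>s - R0\<bar>" "y (s - R0) = 1 * Y1 \<bar>s - R0\<bar>" if "s \<in> {R0<..}" for s
        using that by (auto simp: w_def y_def)
      have s: "0 < 1 * (r - R0) \<and> 1 * (r - R0) < \<epsilon>" using True r by (auto simp: J_def)
      note b = b1[THEN conjunct2, THEN conjunct2, THEN conjunct2, rule_format, OF s]
      have r': "r \<in> {R0<..}" using True by simp
      show ?thesis
        unfolding u_def[of r] u'_def[of r] eq[OF r']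
      proof (intro conjI b[THEN conjunct1])
        show "(u has_real_derivative \<bar>r - R0\<bar> powr (2 / (1 - p) - 1) * (1 * Y1 \<bar>r - R0\<bar>)) (at r)"
          by (rule has_field_derivative_transform_within_open[OF b[THEN conjunct2, THEN conjunct1] _ r'])
            (simp_all only: u_def eq open_greaterThan)
        show "(u' has_real_derivative (\<bar>r - R0\<bar> powr (2 / (1 - p)) * (c + W1 \<bar>r - R0\<bar>)) powr p
          - (real N - 1) / r * (\<bar>r - R0\<bar> powr (2 / (1 - p) - 1) * (1 * Y1 \<bar>r - R0\<bar>))
          - \<mu> / (\<delta> r)\<^sup>2 * (\<bar>r - R0\<bar> powr (2 / (1 - p)) * (c + W1 \<bar>r - R0\<bar>))) (at r)"
          by (rule has_field_derivative_transform_within_open[OF b[THEN conjunct2, THEN conjunct2] _ r'])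
            (simp_all only: u'_def eq open_greaterThan)
      qed
    next
      case False
      have eq: "w (s - R0) = W2 \<bar>s - R0\<bar>" "y (s - R0) = - 1 * Y2 \<bar>s - R0\<bar>" if "s \<in> {..<R0}" for s
        using that by (auto simp: w_def y_def)
      have s: "0 < - 1 * (r - R0) \<and> - 1 * (r - R0) < \<epsilon>" using False r by (auto simp: J_def)
      note b = b2[THEN conjunct2, THEN conjunct2, THEN conjunct2, rule_format, OF s]
      have r': "r \<in> {..<R0}" using False r by simp
      show ?thesis
        unfolding u_def[of r] u'_def[of r] eq[OF r']
      proof (intro conjI b[THEN conjunct1])
        show "(u has_real_derivative \<bar>r - R0\<bar> powr (2 / (1 - p) - 1) * (- 1 * Y2 \<bar>r - R0\<bar>)) (at r)"
          by (rule has_field_derivative_transform_within_open[OF b[THEN conjunct2, THEN conjunct1] _ r'])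
            (simp_all only: u_def eq open_lessThan)
        show "(u' has_real_derivative (\<bar>r - R0\<bar> powr (2 / (1 - p)) * (c + W2 \<bar>r - R0\<bar>)) powr p
          - (real N - 1) / r * (\<bar>r - R0\<bar> powr (2 / (1 - p) - 1) * (- 1 * Y2 \<bar>r - R0\<bar>))
          - \<mu> / (\<delta> r)\<^sup>2 * (\<bar>r - R0\<bar> powr (2 / (1 - p)) * (c + W2 \<bar>r - R0\<bar>))) (at r)"
          by (rule has_field_derivative_transform_within_open[OF b[THEN conjunct2, THEN conjunct2] _ r'])
            (simp_all only: u'_def eq open_lessThan)
      qed
    qed
    then show "0 < c + w (r - R0)" "(u has_real_derivative u' r) (at r)"
      "(u' has_real_derivative u r powr p - (real N - 1) / r * u' r - \<mu> / (\<delta> r)\<^sup>2 * u r) (at r)"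
      by blast+
  qed (simp_all only: u_def u'_def)
  then show ?thesis using \<epsilon> unfolding J_def c_def by blast
qed

section \<open>The centre of the ball\<close>

text \<open>At the origin the drift is singular and the potential is not: a = N - 1, m = 0, P = 0,
  and the potential is the remainder Q on [0, R/2], where R - t stays away from 0. The drift adds
  \<alpha> (N - 1) to \<open>mu_star p\<close>.\<close>

lemma solution_at_origin:
  assumes N: "1 \<le> N" and p: "0 < p" "p < 1" and R: "0 < R"
  shows "\<exists>\<epsilon>>0. \<epsilon> \<le> R \<and>
           (\<exists>u w. radial_solution_on {0<..<\<epsilon>} N p \<mu> (delta_ball R) u \<and>
              (\<forall>r\<in>{0..<\<epsilon>}. u r = r powr (2 / (1 - p)) *
                 ((mu_star p + 2 * (real N - 1) / (1 - p)) powr (1 / (p - 1)) + w r)) \<and>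
              continuous_on {0..<\<epsilon>} w \<and> w 0 = 0)"
proof -
  define \<alpha> where "\<alpha> = 2 / (1 - p)"
  define c where "c = (mu_star p + 2 * (real N - 1) / (1 - p)) powr (1 / (p - 1))"
  have K: "mu_star p + 2 * (real N - 1) / (1 - p) = \<alpha> * (\<alpha> - 1) + \<alpha> * (real N - 1) + 0"
    using p by (simp add: mu_star_eq \<alpha>_def)
  have "0 < mu_star p" using p by (simp add: mu_star_def)
  moreover have "0 \<le> 2 * (real N - 1) / (1 - p)" using N p by simp
  ultimately have K0: "0 < \<alpha> * (\<alpha> - 1) + \<alpha> * (real N - 1) + 0" unfolding K[symmetric] by linarith
  have Q: "continuous_on {0..R/2} (\<lambda>t. \<mu> / (R - t)\<^sup>2)" using R by (auto intro!: continuous_intros)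
  have N': "0 \<le> real N - 1" and R2: "0 < R / 2" using N R by auto
  show ?thesis
  proof (rule local_solution[OF p \<alpha>_def N' K0 c_def[unfolded K] R2 continuous_on_const[of _ 0] Q])
    fix \<epsilon> \<omega> y
    assume \<epsilon>: "0 < \<epsilon>" "\<epsilon> \<le> R / 2" and cont: "continuous_on UNIV \<omega>" "continuous_on UNIV y"
    and c0: "\<And>t. 0 < t \<Longrightarrow> t < \<epsilon> \<Longrightarrow> 0 < c + t * \<omega> t"
    and dU: "\<And>t. 0 < t \<Longrightarrow> t < \<epsilon> \<Longrightarrow>
      ((\<lambda>t. t powr \<alpha> * (c + t * \<omega> t)) has_real_derivative t powr (\<alpha> - 1) * y t) (at t)"
    and dU': "\<And>t. 0 < t \<Longrightarrow> t < \<epsilon> \<Longrightarrow>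
      ((\<lambda>t. t powr (\<alpha> - 1) * y t) has_real_derivative
        (t powr \<alpha> * (c + t * \<omega> t)) powr p - ((real N - 1) / t + 0) * (t powr (\<alpha> - 1) * y t)
        - (0 / t\<^sup>2 + \<mu> / (R - t)\<^sup>2) * (t powr \<alpha> * (c + t * \<omega> t))) (at t)"
  have "radial_solution_on {0<..<\<epsilon>} N p \<mu> (delta_ball R) (\<lambda>t. t powr \<alpha> * (c + t * \<omega> t))"
  proof (rule radial_solution_onI[OF p(1), where u'="\<lambda>t. t powr (\<alpha> - 1) * y t"])
    show "continuous_on {0<..<\<epsilon>} (delta_ball R)"
      unfolding delta_ball_def[abs_def] by (intro continuous_intros)
    fix r assume r: "r \<in> {0<..<\<epsilon>}"
    show "r \<noteq> 0 \<and> delta_ball R r \<noteq> 0" using r \<epsilon> by (auto simp: delta_ball_def)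
    show "0 \<le> r powr \<alpha> * (c + r * \<omega> r)" using c0[of r] r by simp
    show "((\<lambda>t. t powr \<alpha> * (c + t * \<omega> t)) has_real_derivative r powr (\<alpha> - 1) * y r) (at r)"
      using dU r by simp
    show "((\<lambda>t. t powr (\<alpha> - 1) * y t) has_real_derivative
        (r powr \<alpha> * (c + r * \<omega> r)) powr p - (real N - 1) / r * (r powr (\<alpha> - 1) * y r)
        - \<mu> / (delta_ball R r)\<^sup>2 * (r powr \<alpha> * (c + r * \<omega> r))) (at r)"
      using dU'[of r] r by (simp add: delta_ball_def)
  qed
  moreover have "continuous_on {0..<\<epsilon>} (\<lambda>t. t * \<omega> t)"
    by (intro continuous_intros continuous_on_subset[OF cont(1)]) auto
  ultimately show "\<exists>\<epsilon>>0. \<epsilon> \<le> R \<and>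
           (\<exists>u w. radial_solution_on {0<..<\<epsilon>} N p \<mu> (delta_ball R) u \<and>
              (\<forall>r\<in>{0..<\<epsilon>}. u r = r powr (2 / (1 - p)) *
                 ((mu_star p + 2 * (real N - 1) / (1 - p)) powr (1 / (p - 1)) + w r)) \<and>
              continuous_on {0..<\<epsilon>} w \<and> w 0 = 0)"
    using \<epsilon> R unfolding \<alpha>_def[symmetric] c_def[symmetric]
    by (intro exI[of _ \<epsilon>] conjI exI[of _ "\<lambda>t. t powr \<alpha> * (c + t * \<omega> t)"] exI[of _ "\<lambda>t. t * \<omega> t"]) auto
  qed
qed

theorem lemma2p1:
  fixes N :: nat and p \<mu> :: real
  assumes "N \<ge> 1" and "0 < p" and "p < 1" and "\<mu> \<noteq> 0"
  shows
    "((\<forall>R R0. 0 < R0 \<and> R0 < R \<longrightarrow>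
         (\<exists>\<epsilon>>0. vanishing_solution {0<..<R} N p \<mu> (delta_ball R)
            (mu_star p powr (1 / (p - 1))) R0 {R0-\<epsilon><..<R0+\<epsilon>})) \<and>
      (\<forall>r0 R R0. 0 < r0 \<and> r0 < R0 \<and> R0 < R \<longrightarrow>
         (\<exists>\<epsilon>>0. vanishing_solution {r0<..<R} N p \<mu> (delta_annulus r0 R)
            (mu_star p powr (1 / (p - 1))) R0 {R0-\<epsilon><..<R0+\<epsilon>}))) \<and>
     (\<mu> > - mu_star p \<longrightarrow>
      (\<forall>R. 0 < R \<longrightarrow>
         (\<exists>\<epsilon>>0. vanishing_solution {0<..<R} N p \<mu> (delta_ball R)
            ((mu_star p + \<mu>) powr (1 / (p - 1))) R {R-\<epsilon><..R})) \<and>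
      (\<forall>r0 R. 0 < r0 \<and> r0 < R \<longrightarrow>
         (\<exists>\<epsilon>>0. vanishing_solution {r0<..<R} N p \<mu> (delta_annulus r0 R)
            ((mu_star p + \<mu>) powr (1 / (p - 1))) R {R-\<epsilon><..R}) \<and>
         (\<exists>\<epsilon>>0. vanishing_solution {r0<..<R} N p \<mu> (delta_annulus r0 R)
            ((mu_star p + \<mu>) powr (1 / (p - 1))) r0 {r0..<r0+\<epsilon>}))) \<and>
     (\<forall>R. 0 < R \<longrightarrow>
        (\<exists>\<epsilon>>0. \<epsilon> \<le> R \<and>
           (\<exists>u w. radial_solution_on {0<..<\<epsilon>} N p \<mu> (delta_ball R) u \<and>
              (\<forall>r\<in>{0..<\<epsilon>}. u r = r powr (2 / (1 - p)) *
                 ((mu_star p + 2 * (real N - 1) / (1 - p)) powr (1 / (p - 1)) + w r)) \<and>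
              continuous_on {0..<\<epsilon>} w \<and> w 0 = 0)))"
proof (intro conjI allI impI)
  note p = assms(2,3)
  have ball: "continuous_on S (delta_ball R)" for S R
    unfolding delta_ball_def[abs_def] by (intro continuous_intros)
  have annulus: "continuous_on S (delta_annulus r0 R)" for S r0 R
    unfolding delta_annulus_def[abs_def] by (intro continuous_intros)
  \<comment> \<open>The one-sided neighbourhoods for \<sigma> = -1 and \<sigma> = 1, rewritten as
    intervals.\<close>
  have left: "{r. 0 \<le> - 1 * (r - R) \<and> - 1 * (r - R) < \<epsilon>} = {R-\<epsilon><..R}" for R \<epsilon> :: real
    by auto
  have right: "{r. 0 \<le> 1 * (r - R) \<and> 1 * (r - R) < \<epsilon>} = {R..<R+\<epsilon>}" for R \<epsilon> :: real
    by auto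
  show "\<exists>\<epsilon>>0. vanishing_solution {0<..<R} N p \<mu> (delta_ball R)
      (mu_star p powr (1 / (p - 1))) R0 {R0-\<epsilon><..<R0+\<epsilon>}" if "0 < R0 \<and> R0 < R" for R R0
    using that by (intro vanishing_solution_interior p ball) (auto simp: delta_ball_def)
  show "\<exists>\<epsilon>>0. vanishing_solution {r0<..<R} N p \<mu> (delta_annulus r0 R)
      (mu_star p powr (1 / (p - 1))) R0 {R0-\<epsilon><..<R0+\<epsilon>}" if "0 < r0 \<and> r0 < R0 \<and> R0 < R" for r0 R R0
    using that by (intro vanishing_solution_interior p annulus) (auto simp: delta_annulus_def)
  show "\<exists>\<epsilon>>0. vanishing_solution {0<..<R} N p \<mu> (delta_ball R)
      ((mu_star p + \<mu>) powr (1 / (p - 1))) R {R-\<epsilon><..R}" if "- mu_star p < \<mu>" "0 < R" for R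
    unfolding left[symmetric]
    by (rule vanishing_solution_boundary[OF p _ _ _ _ _ _ _ ball, where d="R / 2"])
      (use that in \<open>auto simp: delta_ball_def\<close>)
  show "\<exists>\<epsilon>>0. vanishing_solution {r0<..<R} N p \<mu> (delta_annulus r0 R)
      ((mu_star p + \<mu>) powr (1 / (p - 1))) R {R-\<epsilon><..R}"
    if "- mu_star p < \<mu>" "0 < r0 \<and> r0 < R" for r0 R
    unfolding left[symmetric]
    \<comment> \<open>Up to the middle of the annulus the minimum in \<delta> is the distance to the
      chosen endpoint.\<close>
    by (rule vanishing_solution_boundary[OF p _ _ _ _ _ _ _ annulus, where d="(R - r0) / 2"])
      (use that in \<open>auto simp: delta_annulus_def min_def field_simps\<close>)
  show "\<exists>\<epsilon>>0. vanishing_solution {r0<..<R} N p \<mu> (delta_annulus r0 R)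
      ((mu_star p + \<mu>) powr (1 / (p - 1))) r0 {r0..<r0+\<epsilon>}"
    if "- mu_star p < \<mu>" "0 < r0 \<and> r0 < R" for r0 R
    unfolding right[symmetric]
    by (rule vanishing_solution_boundary[OF p _ _ _ _ _ _ _ annulus, where d="(R - r0) / 2"])
      (use that in \<open>auto simp: delta_annulus_def min_def field_simps\<close>)
qed (use solution_at_origin[OF assms(1-3)] in blast)

end
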